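(* Let $\mu=(\mu_j)_{j\in\mathbb{Z}}\in\ell_1(\mathbb{Z})$ be a sequence of non-negative real numbers with $\mu\neq 0$, and let $\gamma=(\gamma_\ell)_{\ell\in\mathbb{Z}}$ be the non-negative sequence defined by $$\gamma_\ell^2=\sum_{j\in\mathbb{Z}}\mu_j\mu_{j+\ell},\qquad \ell\in\mathbb{Z}.$$ Then for all $n\in\mathbb{N}_0$, $$e_n(H_\gamma,\mathrm{INT})^2\;\ge\;\gamma_0^2\left(1-\frac{n\gamma_0^2}{\|\gamma\|_2^2}\right).$$
   Context: Put $e_j(x)=e^{2\pi i j x}$ for $j\in\mathbb{Z}$, $x\in\mathbb{R}$. For a non-negative sequence $\gamma=(\gamma_j)_{j\in\mathbb{Z}}\in\ell_2(\mathbb{Z})$, $H_\gamma$ denotes the (complex) Hilbert space of all 1-periodic functions $f(x)=\sum_{j\in\mathbb{Z}}\alpha_j e_j(x)$, $x\in[0,1]$, such that $\alpha_j=0$ whenever $\gamma_j=0$ and $\|f\|_{H_\gamma}^2=\sum_{j:\gamma_j\neq 0}|\alpha_j|^2/\gamma_j^2<\infty$. The series converges absolutely and uniformly, and $H_\gamma$ is a reproducing kernel Hilbert space of continuous functions with kernel $K(x,y)=\sum_{j\in\mathbb{Z}}\gamma_j^2e_j(x-y)$. The sequence $\gamma$ in the claim lies in $\ell_2(\mathbb{Z})$, and $\|\gamma\|_2^2=\sum_{\ell\in\mathbb{Z}}\gamma_\ell^2$. $\mathrm{INT}(f)=\int_0^1 f(x)\,dx$. For $n\in\mathbb{N}_0$,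 $$e_n(H_\gamma,\mathrm{INT})=\inf_{Q_n}\ \sup_{\|f\|_{H_\gamma}\le 1}|\mathrm{INT}(f)-Q_n(f)|,$$ where the infimum is over all quadrature formulas $Q_n(f)=\sum_{i=1}^n w_i f(x_i)$ with scalars $w_i\in\mathbb{C}$ and points $x_i\in[0,1]$ ($Q_0=0$). *)

theory Defs
  imports "HOL-Analysis.Analysis"
begin

definition trig :: "int \<Rightarrow> real \<Rightarrow> complex" where
  "trig j x = exp (2 * of_real pi * \<i> * of_int j * of_real x)"

text \<open>
  All sums over the integers are unconditional (\<^const>\<open>has_sum\<close>), which for complex terms is
  absolute convergence.  Functions are taken on the whole real line; 1-periodicity is a
  consequence of the expansion.
\<close>

definition H_expansion :: "(int \<Rightarrow> real) \<Rightarrow> (real \<Rightarrow> complex) \<Rightarrow> (int \<Rightarrow> complex) \<Rightarrow> bool" where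
  "H_expansion \<gamma> f \<alpha> \<longleftrightarrow>
     (\<forall>j. \<gamma> j = 0 \<longrightarrow> \<alpha> j = 0) \<and>
     (\<lambda>j. (cmod (\<alpha> j))\<^sup>2 / (\<gamma> j)\<^sup>2) summable_on {j. \<gamma> j \<noteq> 0} \<and>
     (\<forall>x. ((\<lambda>j. \<alpha> j * trig j x) has_sum f x) UNIV)"

definition H_space :: "(int \<Rightarrow> real) \<Rightarrow> (real \<Rightarrow> complex) set" where
  "H_space \<gamma> = {f. \<exists>\<alpha>. H_expansion \<gamma> f \<alpha>}"

definition H_coeff :: "(int \<Rightarrow> real) \<Rightarrow> (real \<Rightarrow> complex) \<Rightarrow> int \<Rightarrow> complex" where
  "H_coeff \<gamma> f = (THE \<alpha>. H_expansion \<gamma> f \<alpha>)"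

lemma norm_trig [simp]: "cmod (trig j x) = 1"
  by (simp add: trig_def)

lemma continuous_on_trig [continuous_intros]: "continuous_on S (trig j)"
  unfolding trig_def by (intro continuous_intros)

lemma trig_mult: "trig j x * trig k x = trig (j + k) x"
  by (simp add: trig_def exp_add [symmetric] algebra_simps)

lemma has_integral_trig: "(trig j has_integral (if j = 0 then 1 else 0)) {0..1}"
proof (cases "j = 0")
  case True
  then show ?thesis
    using has_integral_const_real [of "1::complex" 0 1] by (simp add: trig_def [abs_def])
next
  case False
  define c where "c = 2 * of_real pi * \<i> * of_int j"
  have c0: "c \<noteq> 0" using False by (simp add: c_def)
  have "((\<lambda>x. exp (c * of_real x) / c) has_vector_derivative exp (c * of_real x)) (at x within {0..1})"
    for x :: real
    unfolding has_vector_derivative_real_field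
    by (rule has_vector_derivative_real_field [where f = "\<lambda>z. exp (c * z) / c"])
       (use c0 in \<open>auto intro!: derivative_eq_intros\<close>)
  then have "((\<lambda>x. exp (c * of_real x)) has_integral
      exp (c * of_real 1) / c - exp (c * of_real 0) / c) {0..1}"
    by (intro fundamental_theorem_of_calculus) auto
  moreover have "exp c = 1"
    unfolding c_def exp_eq_1 by (auto intro: exI [of _ j])
  ultimately show ?thesis
    using False by (simp add: trig_def [abs_def] c_def)
qed

lemma H_expansion_abs_summable:
  assumes "H_expansion \<gamma> f \<alpha>"
  shows "(\<lambda>j. cmod (\<alpha> j)) summable_on UNIV"
proof -
  have "((\<lambda>j. \<alpha> j * trig j 0) has_sum f 0) UNIV"
    using assms by (auto simp: H_expansion_def)
  then have "\<alpha> summable_on UNIV"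
    by (auto simp: trig_def has_sum_iff)
  then show ?thesis
    by (simp add: summable_on_iff_abs_summable_on_complex)
qed

lemma H_expansion_Fourier:
  assumes "H_expansion \<gamma> f \<alpha>"
  shows "((\<lambda>x. f x * trig (- k) x) has_integral \<alpha> k) {0..1}"
proof -
  have sums: "((\<lambda>j. \<alpha> j * trig j x * trig (-k) x) has_sum (f x * trig (-k) x)) UNIV" for x
    using assms by (intro has_sum_cmult_left) (auto simp: H_expansion_def)
  have "uniform_limit {0..1} (\<lambda>F x. \<Sum>j\<in>F. \<alpha> j * trig j x * trig (-k) x)
          (\<lambda>x. f x * trig (-k) x) (finite_subsets_at_top UNIV)"
    by (rule Weierstrass_m_test_general' [OF _ sums H_expansion_abs_summable [OF assms]])
       (simp add: norm_mult)
  then obtain I J where I: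
      "\<And>F. ((\<lambda>x. \<Sum>j\<in>F. \<alpha> j * trig j x * trig (-k) x) has_integral I F) {0..1}"
      "((\<lambda>x. f x * trig (-k) x) has_integral J) {0..1}"
      "(I \<longlongrightarrow> J) (finite_subsets_at_top UNIV)"
    by (rule uniform_limit_integral) (auto intro!: continuous_intros)
  have "I F = \<alpha> k" if "finite F" "{k} \<subseteq> F" for F
  proof -
    have "((\<lambda>x. \<Sum>j\<in>F. \<alpha> j * trig (j - k) x) has_integral
        (\<Sum>j\<in>F. \<alpha> j * (if j - k = 0 then 1 else 0))) {0..1}"
      using that by (intro has_integral_sum has_integral_mult_right has_integral_trig) auto
    moreover have "(\<Sum>j\<in>F. \<alpha> j * (if j - k = 0 then 1 else 0)) = \<alpha> k"
      using that by (simp add: if_distrib cong: if_cong)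
    ultimately show ?thesis
      using I(1) [of F] by (simp add: mult.assoc trig_mult has_integral_unique)
  qed
  then have "\<forall>\<^sub>F F in finite_subsets_at_top UNIV. I F = \<alpha> k"
    unfolding eventually_finite_subsets_at_top by (intro exI [of _ "{k}"]) auto
  then have "(I \<longlongrightarrow> \<alpha> k) (finite_subsets_at_top UNIV)"
    by (rule tendsto_eventually)
  then have "J = \<alpha> k"
    using I(3) tendsto_unique [OF finite_subsets_at_top_neq_bot] by blast
  with I(2) show ?thesis by simp
qed

lemma H_expansion_unique:
  assumes "H_expansion \<gamma> f \<alpha>" "H_expansion \<gamma> f \<beta>"
  shows "\<alpha> = \<beta>"
  using has_integral_unique [OF H_expansion_Fourier [OF assms(1)] H_expansion_Fourier [OF assms(2)]]
  by blast

lemma H_coeff_eq: "H_expansion \<gamma> f \<alpha> \<Longrightarrow> H_coeff \<gamma> f = \<alpha>"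
  unfolding H_coeff_def by (blast intro: the_equality H_expansion_unique)

definition H_norm :: "(int \<Rightarrow> real) \<Rightarrow> (real \<Rightarrow> complex) \<Rightarrow> real" where
  "H_norm \<gamma> f = sqrt (\<Sum>\<^sub>\<infinity>j\<in>{j. \<gamma> j \<noteq> 0}. (cmod (H_coeff \<gamma> f j))\<^sup>2 / (\<gamma> j)\<^sup>2)"

definition INT01 :: "(real \<Rightarrow> complex) \<Rightarrow> complex" where
  "INT01 f = integral {0..1} f"

definition quadrature :: "nat \<Rightarrow> (nat \<Rightarrow> complex) \<Rightarrow> (nat \<Rightarrow> real) \<Rightarrow> (real \<Rightarrow> complex) \<Rightarrow> complex" where
  "quadrature n w x f = (\<Sum>i<n. w i * f (x i))"

definition worst_case_error :: "(int \<Rightarrow> real) \<Rightarrow> ((real \<Rightarrow> complex) \<Rightarrow> complex) \<Rightarrow> real" where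
  "worst_case_error \<gamma> Q = (SUP f\<in>{f \<in> H_space \<gamma>. H_norm \<gamma> f \<le> 1}. cmod (INT01 f - Q f))"

definition min_error :: "nat \<Rightarrow> (int \<Rightarrow> real) \<Rightarrow> real" where
  "min_error n \<gamma> =
     (INF Q\<in>{quadrature n w x | w x. \<forall>i<n. x i \<in> {0..1}}. worst_case_error \<gamma> Q)"

text \<open>
  For square-summable \<open>\<gamma>\<close> the supremum defining the worst case error is over a bounded,
  non-empty set of reals, so it is the genuine supremum.
\<close>

lemma zero_in_unit_ball: "(\<lambda>_. 0) \<in> {f \<in> H_space \<gamma>. H_norm \<gamma> f \<le> 1}"
proof -
  have "H_expansion \<gamma> (\<lambda>_. 0) (\<lambda>_. 0)"
    by (simp add: H_expansion_def)
  then show ?thesis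
    by (auto simp: H_space_def H_norm_def H_coeff_eq)
qed

lemma unit_ball_bound:
  assumes \<gamma>: "(\<lambda>j. (\<gamma> j)\<^sup>2) summable_on UNIV" and f: "f \<in> H_space \<gamma>" "H_norm \<gamma> f \<le> 1"
  shows "cmod (f x) \<le> 1 + (\<Sum>\<^sub>\<infinity>j. (\<gamma> j)\<^sup>2)"
proof -
  obtain \<alpha> where \<alpha>: "H_expansion \<gamma> f \<alpha>" using f by (auto simp: H_space_def)
  define S where "S = {j. \<gamma> j \<noteq> 0}"
  define g where "g = (\<lambda>j. (cmod (\<alpha> j))\<^sup>2 / (\<gamma> j)\<^sup>2)"
  have gS: "g summable_on S" and z: "\<And>j. \<gamma> j = 0 \<Longrightarrow> \<alpha> j = 0"
    and sf: "((\<lambda>j. \<alpha> j * trig j x) has_sum f x) UNIV"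
    using \<alpha> by (auto simp: H_expansion_def g_def S_def)
  have g0: "g j = 0" if "j \<notin> S" for j using that by (simp add: g_def S_def)
  have gU: "g summable_on UNIV" 
    using gS summable_on_cong_neutral [of S UNIV g g] g0 by auto
  have "infsum g UNIV = infsum g S" by (rule infsum_cong_neutral) (auto simp: g0)
  moreover have "sqrt (infsum g S) \<le> 1" using f(2)
    by (simp add: H_norm_def H_coeff_eq [OF \<alpha>] g_def S_def)
  ultimately have le1: "infsum g UNIV \<le> 1" by simp
  have pt: "cmod (\<alpha> j * trig j x) \<le> g j + (\<gamma> j)\<^sup>2" for j
  proof (cases "\<gamma> j = 0")
    case True then show ?thesis by (simp add: z g_def)
  next
    case False
    define t where "t = cmod (\<alpha> j) / \<bar>\<gamma> j\<bar>"
    have "0 \<le> (t - \<bar>\<gamma> j\<bar>)\<^sup>2" by simp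
    then have "2 * (t * \<bar>\<gamma> j\<bar>) \<le> t\<^sup>2 + (\<gamma> j)\<^sup>2" by (simp add: power2_diff)
    moreover have "t * \<bar>\<gamma> j\<bar> = cmod (\<alpha> j)" using False by (simp add: t_def)
    moreover have "t\<^sup>2 = g j" by (simp add: t_def g_def power_divide)
    ultimately have "2 * cmod (\<alpha> j) \<le> g j + (\<gamma> j)\<^sup>2" by simp
    then have "cmod (\<alpha> j) \<le> g j + (\<gamma> j)\<^sup>2" using norm_ge_zero [of "\<alpha> j"] by linarith
    then show ?thesis by (simp add: norm_mult)
  qed
  have "cmod (f x) = cmod (\<Sum>\<^sub>\<infinity>j. \<alpha> j * trig j x)" using sf by (simp add: has_sum_iff)
  also have "\<dots> \<le> (\<Sum>\<^sub>\<infinity>j. cmod (\<alpha> j * trig j x))"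
    using H_expansion_abs_summable [OF \<alpha>] by (intro norm_infsum_bound) (simp add: norm_mult)
  also have "\<dots> \<le> (\<Sum>\<^sub>\<infinity>j. g j + (\<gamma> j)\<^sup>2)"
    using H_expansion_abs_summable [OF \<alpha>] gU \<gamma> pt
    by (intro infsum_mono summable_on_add) (auto simp: norm_mult)
  also have "\<dots> = infsum g UNIV + (\<Sum>\<^sub>\<infinity>j. (\<gamma> j)\<^sup>2)"
    using gU \<gamma> by (rule infsum_add)
  finally show ?thesis using le1 by simp
qed

lemma bdd_above_worst_case_error:
  assumes "(\<lambda>j. (\<gamma> j)\<^sup>2) summable_on UNIV"
  shows "bdd_above ((\<lambda>f. cmod (INT01 f - quadrature n w x f)) ` {f \<in> H_space \<gamma>. H_norm \<gamma> f \<le> 1})"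
proof (rule bdd_aboveI2)
  fix f assume f: "f \<in> {f \<in> H_space \<gamma>. H_norm \<gamma> f \<le> 1}"
  define B where "B = 1 + (\<Sum>\<^sub>\<infinity>j. (\<gamma> j)\<^sup>2)"
  have fB: "cmod (f x) \<le> B" for x
    using unit_ball_bound [OF assms] f by (simp add: B_def)
  obtain \<alpha> where \<alpha>: "H_expansion \<gamma> f \<alpha>" using f by (auto simp: H_space_def)
  have i: "f integrable_on {0..1}"
    using H_expansion_Fourier [OF \<alpha>, of 0] by (auto simp: trig_def integrable_on_def)
  have B0: "0 \<le> B" using fB [of 0] norm_ge_zero order_trans by blast
  have "cmod (INT01 f) \<le> B"
    using has_integral_bound [OF B0, of f "INT01 f" 0 1] i fB
    by (simp add: INT01_def has_integral_integral)
  moreover have "cmod (quadrature n w x f) \<le> (\<Sum>i<n. cmod (w i) * B)"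
    unfolding quadrature_def
    by (rule sum_norm_le) (auto simp: norm_mult intro!: mult_left_mono fB)
  ultimately show "cmod (INT01 f - quadrature n w x f) \<le> B + (\<Sum>i<n. cmod (w i) * B)"
    using norm_triangle_ineq4 [of "INT01 f" "quadrature n w x f"] by linarith
qed

end

theory Submission
  imports Defs
begin

text \<open>
  The kernel is a squared modulus: with \<open>c l = (\<Sum>i<n. w i * trig l (x i))\<close> the squared worst case
  error is the sum over \<open>l\<close> of \<open>(\<gamma> l)\<^sup>2 * \<bar>\<delta> l - c l\<bar>\<^sup>2\<close>, where \<open>\<delta>\<close> is the unit mass at \<open>0\<close>. Expanding the
  square leaves the quadratic term \<open>T\<close>, the sum over \<open>j, k\<close> of \<open>\<mu> j * \<mu> k * \<bar>c (k - j)\<bar>\<^sup>2\<close>. This is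
  the squared Frobenius norm of a matrix of rank at most \<open>n\<close> with trace \<open>M * c 0\<close>, where \<open>M\<close> is the
  sum of \<open>\<mu>\<close>; since a matrix \<open>B\<close> of rank at most \<open>n\<close> satisfies \<open>\<bar>tr B\<bar>\<^sup>2 \<le> n * \<parallel>B\<parallel>\<^sup>2\<close>, it follows that
  \<open>M\<^sup>2 * \<bar>c 0\<bar>\<^sup>2 \<le> n * T\<close>. As \<open>M\<^sup>2\<close> is the sum of all \<open>(\<gamma> l)\<^sup>2\<close>, minimising over \<open>c 0\<close> gives the bound.
\<close>

section \<open>Finite-rank matrices: trace against Frobenius norm\<close>

text \<open>Gram-Schmidt, one vector at a time: \<open>P\<close> is built as the orthogonal
  projection onto the span of the \<open>v i\<close> on \<open>F\<close>. A new vector raises the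
  trace by 1 or, if dependent on the earlier ones, not at all, so only an upper bound on the trace
  is claimed.\<close>

lemma finite_rank_projection:
  fixes v :: "nat \<Rightarrow> 'a \<Rightarrow> complex"
  assumes F: "finite F"
  shows "\<exists>P. (\<forall>j\<in>F. \<forall>k\<in>F. cnj (P j k) = P k j) \<and>
      (\<forall>j\<in>F. \<forall>l\<in>F. (\<Sum>k\<in>F. P j k * P k l) = P j l) \<and>
      (\<forall>i<n. \<forall>j\<in>F. (\<Sum>k\<in>F. P j k * v i k) = v i j) \<and>
      Re (\<Sum>j\<in>F. P j j) \<le> real n"
proof (induction n)
  case 0
  show ?case by (rule exI [of _ "\<lambda>_ _. 0"]) simp
next
  case (Suc n)
  then obtain P where herm: "\<And>j k. j \<in> F \<Longrightarrow> k \<in> F \<Longrightarrow> cnj (P j k) = P k j"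
    and idem: "\<And>j l. j \<in> F \<Longrightarrow> l \<in> F \<Longrightarrow> (\<Sum>k\<in>F. P j k * P k l) = P j l"
    and fixv: "\<And>i j. i < n \<Longrightarrow> j \<in> F \<Longrightarrow> (\<Sum>k\<in>F. P j k * v i k) = v i j"
    and tr: "Re (\<Sum>j\<in>F. P j j) \<le> real n"
    by blast
  \<comment> \<open>\<open>q\<close> is the part of the new vector orthogonal to the range of
    \<open>P\<close>, and \<open>N\<close> its squared length; \<open>N = 0\<close> means that
    \<open>P\<close> already fixes \<open>v n\<close>.\<close>
  define q where "q = (\<lambda>j. v n j - (\<Sum>k\<in>F. P j k * v n k))"
  define N where "N = (\<Sum>j\<in>F. (cmod (q j))\<^sup>2)"
  show ?case
  proof (cases "N = 0")
    case True
    then have "q j = 0" if "j \<in> F" for j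
      using that F by (simp add: N_def sum_nonneg_eq_0_iff)
    then have "(\<Sum>k\<in>F. P j k * v i k) = v i j" if "i < Suc n" "j \<in> F" for i j
      using that fixv by (cases "i = n") (auto simp: q_def)
    then show ?thesis using herm idem tr by (intro exI [of _ P]) auto
  next
    case False
    \<comment> \<open>Adds the orthogonal projection onto the line of \<open>q\<close>, which has
      trace 1.\<close>
    define P' where "P' = (\<lambda>j k. P j k + q j * cnj (q k) / of_real N)"
    have Pq: "(\<Sum>k\<in>F. P j k * q k) = 0" if j: "j \<in> F" for j
    proof -
      have "(\<Sum>k\<in>F. P j k * (\<Sum>l\<in>F. P k l * v n l)) = (\<Sum>k\<in>F. \<Sum>l\<in>F. P j k * P k l * v n l)"
        by (simp add: sum_distrib_left mult.assoc)
      also have "\<dots> = (\<Sum>l\<in>F. \<Sum>k\<in>F. P j k * P k l * v n l)" by (rule sum.swap)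
      also have "\<dots> = (\<Sum>l\<in>F. P j l * v n l)"
        using idem j by (intro sum.cong refl) (simp flip: sum_distrib_right)
      finally show ?thesis by (simp add: q_def right_diff_distrib sum_subtractf)
    qed
    have qP: "(\<Sum>j\<in>F. cnj (q j) * P j k) = 0" if k: "k \<in> F" for k
    proof -
      have "(\<Sum>j\<in>F. cnj (q j) * P j k) = cnj (\<Sum>j\<in>F. P k j * q j)"
        using herm k by (simp add: mult.commute)
      then show ?thesis using Pq [OF k] by simp
    qed
    have qPv: "(\<Sum>k\<in>F. cnj (q k) * (\<Sum>m\<in>F. P k m * f m)) = 0" for f
    proof -
      have "(\<Sum>k\<in>F. cnj (q k) * (\<Sum>m\<in>F. P k m * f m))
          = (\<Sum>k\<in>F. \<Sum>m\<in>F. cnj (q k) * P k m * f m)"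
        by (simp add: sum_distrib_left mult.assoc)
      also have "\<dots> = (\<Sum>m\<in>F. \<Sum>k\<in>F. cnj (q k) * P k m * f m)" by (rule sum.swap)
      also have "\<dots> = 0"
        using qP by (intro sum.neutral) (simp flip: sum_distrib_right)
      finally show ?thesis .
    qed
    have qq: "(\<Sum>k\<in>F. cnj (q k) * q k) = of_real N"
      by (simp add: N_def complex_norm_square mult.commute del: of_real_power)
    have qv: "(\<Sum>k\<in>F. cnj (q k) * v i k) = 0" if "i < n" for i
    proof -
      have "(\<Sum>k\<in>F. cnj (q k) * v i k) = (\<Sum>k\<in>F. cnj (q k) * (\<Sum>m\<in>F. P k m * v i m))"
        using fixv that by (intro sum.cong) auto
      then show ?thesis using qPv by simp
    qed
    \<comment> \<open>\<open>v n\<close> and \<open>q\<close> differ by an element of the range of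
      \<open>P\<close>, which \<open>q\<close> annihilates; hence the correction term of
      \<open>P'\<close> sends \<open>v n\<close> to exactly \<open>q\<close>.\<close>
    have qvn: "(\<Sum>k\<in>F. cnj (q k) * v n k) = of_real N"
    proof -
      have "(\<Sum>k\<in>F. cnj (q k) * v n k)
          = (\<Sum>k\<in>F. cnj (q k) * q k) + (\<Sum>k\<in>F. cnj (q k) * (\<Sum>m\<in>F. P k m * v n m))"
        by (simp add: q_def right_diff_distrib sum_subtractf)
      then show ?thesis by (simp only: qq qPv add_0_right)
    qed
    have P'v: "(\<Sum>k\<in>F. P' j k * f k)
        = (\<Sum>k\<in>F. P j k * f k) + q j / of_real N * (\<Sum>k\<in>F. cnj (q k) * f k)" for f j
      by (simp add: P'_def ring_distribs sum.distrib sum_distrib_left mult_ac)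
    have herm': "cnj (P' j k) = P' k j" if "j \<in> F" "k \<in> F" for j k
      using herm [OF that] by (simp add: P'_def mult.commute)
    have idem': "(\<Sum>k\<in>F. P' j k * P' k l) = P' j l" if "j \<in> F" "l \<in> F" for j l
    proof -
      have e: "(\<Sum>k\<in>F. g k * P' k l)
          = (\<Sum>k\<in>F. g k * P k l) + (\<Sum>k\<in>F. g k * q k) * (cnj (q l) / of_real N)" for g
        by (simp add: P'_def distrib_left sum.distrib sum_distrib_left sum_divide_distrib mult_ac)
      show ?thesis
        unfolding P'v e using idem that Pq qP qq False by (simp add: P'_def)
    qed
    have fix': "(\<Sum>k\<in>F. P' j k * v i k) = v i j" if "i < Suc n" "j \<in> F" for i j
    proof (cases "i = n")
      case True
      show ?thesis unfolding True P'v qvn using False by (simp add: q_def)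
    next
      case i: False
      then show ?thesis unfolding P'v using that qv fixv by simp
    qed
    have "(\<Sum>j\<in>F. P' j j) = (\<Sum>j\<in>F. P j j) + (\<Sum>j\<in>F. cnj (q j) * q j) / of_real N"
      by (simp add: P'_def sum.distrib sum_divide_distrib mult.commute)
    then have "Re (\<Sum>j\<in>F. P' j j) \<le> real (Suc n)"
      using tr False by (simp only: qq) simp
    then show ?thesis using herm' idem' fix' by (intro exI [of _ P']) auto
  qed
qed

text \<open>For \<open>B = (\<Sum>i<n. a i j * b i k)\<close> and a projection \<open>P\<close>
  fixing its columns, tr B = tr (P B). Cauchy-Schwarz over pairs of indices then leaves the squared
  Frobenius norm of \<open>P\<close>, which is its trace and at most \<open>n\<close>.\<close>

lemma trace_square_le_rank:
  fixes a b :: "nat \<Rightarrow> 'a \<Rightarrow> complex"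
  assumes F: "finite F"
  shows "(cmod (\<Sum>j\<in>F. \<Sum>i<n. a i j * b i j))\<^sup>2
    \<le> real n * (\<Sum>j\<in>F. \<Sum>k\<in>F. (cmod (\<Sum>i<n. a i j * b i k))\<^sup>2)"
proof -
  obtain P where herm: "\<And>j k. j \<in> F \<Longrightarrow> k \<in> F \<Longrightarrow> cnj (P j k) = P k j"
    and idem: "\<And>j l. j \<in> F \<Longrightarrow> l \<in> F \<Longrightarrow> (\<Sum>k\<in>F. P j k * P k l) = P j l"
    and fixa: "\<And>i j. i < n \<Longrightarrow> j \<in> F \<Longrightarrow> (\<Sum>k\<in>F. P j k * a i k) = a i j"
    and tr: "Re (\<Sum>j\<in>F. P j j) \<le> real n"
    using finite_rank_projection [OF F, of n a] by blast
  define B where "B = (\<lambda>j k. \<Sum>i<n. a i j * b i k)"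
  \<comment> \<open>Each column of \<open>B\<close> is a combination of the \<open>a i\<close>, all
    fixed by \<open>P\<close>.\<close>
  have PB: "(\<Sum>k\<in>F. P j k * B k l) = B j l" if j: "j \<in> F" for j l
  proof -
    have "(\<Sum>k\<in>F. P j k * B k l) = (\<Sum>i<n. \<Sum>k\<in>F. P j k * a i k * b i l)"
      unfolding B_def sum_distrib_left mult.assoc by (rule sum.swap)
    also have "\<dots> = B j l"
      unfolding B_def using fixa j by (intro sum.cong) (simp_all flip: sum_distrib_right)
    finally show ?thesis .
  qed
  \<comment> \<open>\<open>P\<close> is an orthogonal projection, so its squared Frobenius norm is its trace\<close>
  have "complex_of_real (\<Sum>j\<in>F. \<Sum>k\<in>F. (cmod (P j k))\<^sup>2) = (\<Sum>j\<in>F. \<Sum>k\<in>F. P j k * P k j)"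
    unfolding of_real_sum
    by (intro sum.cong refl) (simp add: complex_norm_square herm del: of_real_power)
  also have "\<dots> = (\<Sum>j\<in>F. P j j)" using idem by simp
  finally have tr_sq: "complex_of_real (\<Sum>j\<in>F. \<Sum>k\<in>F. (cmod (P j k))\<^sup>2) = (\<Sum>j\<in>F. P j j)" .
  have "(\<Sum>j\<in>F. \<Sum>k\<in>F. (cmod (P j k))\<^sup>2) = Re (\<Sum>j\<in>F. P j j)"
    unfolding tr_sq [symmetric] by (rule Re_complex_of_real [symmetric])
  then have P_le: "(\<Sum>p\<in>F \<times> F. (cmod (P (fst p) (snd p)))\<^sup>2) \<le> real n"
    using tr by (simp add: sum.cartesian_product' F)
  have tr_B: "(\<Sum>j\<in>F. B j j) = (\<Sum>p\<in>F \<times> F. P (fst p) (snd p) * B (snd p) (fst p))"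
    using PB by (simp add: sum.cartesian_product' F)
  have "cmod (\<Sum>j\<in>F. B j j) \<le> (\<Sum>p\<in>F \<times> F. cmod (P (fst p) (snd p)) * cmod (B (snd p) (fst p)))"
    unfolding tr_B norm_mult [symmetric] by (rule norm_sum)
  then have "(cmod (\<Sum>j\<in>F. B j j))\<^sup>2
      \<le> (\<Sum>p\<in>F \<times> F. cmod (P (fst p) (snd p)) * cmod (B (snd p) (fst p)))\<^sup>2"
    by (intro power_mono) auto
  also have "\<dots> \<le> (\<Sum>p\<in>F \<times> F. (cmod (P (fst p) (snd p)))\<^sup>2) * (\<Sum>p\<in>F \<times> F. (cmod (B (snd p) (fst p)))\<^sup>2)"
    by (rule Cauchy_Schwarz_ineq_sum)
  also have "\<dots> \<le> real n * (\<Sum>p\<in>F \<times> F. (cmod (B (snd p) (fst p)))\<^sup>2)"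
    by (intro mult_right_mono P_le sum_nonneg) auto
  also have "(\<Sum>p\<in>F \<times> F. (cmod (B (snd p) (fst p)))\<^sup>2) = (\<Sum>j\<in>F. \<Sum>k\<in>F. (cmod (B j k))\<^sup>2)"
    by (subst sum.swap) (simp add: sum.cartesian_product' F)
  finally show ?thesis by (simp add: B_def)
qed

text \<open>Since \<open>trig (k - j)\<close> is \<open>trig (- j)\<close> times
  \<open>trig k\<close>, the matrix with entries \<open>sqrt (\<mu> j * \<mu> k)\<close> times the
  sum over \<open>i\<close> has rank at most \<open>n\<close>. On its diagonal the exponentials
  cancel and the weight is \<open>\<mu> j\<close>.\<close>

lemma trig_quadratic_form_lower_bound:
  fixes \<mu> :: "int \<Rightarrow> real"
  assumes F: "finite F" and \<mu>: "\<And>j. \<mu> j \<ge> 0"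
  shows "(\<Sum>j\<in>F. \<mu> j)\<^sup>2 * (cmod (\<Sum>i<n. w i))\<^sup>2
    \<le> real n * (\<Sum>j\<in>F. \<Sum>k\<in>F. \<mu> j * \<mu> k * (cmod (\<Sum>i<n. w i * trig (k - j) (x i)))\<^sup>2)"
proof -
  define a where "a = (\<lambda>i j. w i * (sqrt (\<mu> j) * trig (- j) (x i)))"
  define b where "b = (\<lambda>i k. sqrt (\<mu> k) * trig k (x i))"
  have ab: "(\<Sum>i<n. a i j * b i k) = sqrt (\<mu> j * \<mu> k) * (\<Sum>i<n. w i * trig (k - j) (x i))" for j k
  proof -
    have "a i j * b i k = sqrt (\<mu> j * \<mu> k) * (w i * trig (k - j) (x i))" for i
      using trig_mult [of "- j" "x i" k] by (simp add: a_def b_def real_sqrt_mult mult_ac)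
    then show ?thesis by (simp add: sum_distrib_left)
  qed
  have "(\<Sum>j\<in>F. \<Sum>i<n. a i j * b i j) = of_real (\<Sum>j\<in>F. \<mu> j) * (\<Sum>i<n. w i)"
    unfolding ab using \<mu> by (simp add: trig_def sum_distrib_right)
  then have l: "(cmod (\<Sum>j\<in>F. \<Sum>i<n. a i j * b i j))\<^sup>2 = (\<Sum>j\<in>F. \<mu> j)\<^sup>2 * (cmod (\<Sum>i<n. w i))\<^sup>2"
    by (simp add: norm_mult power_mult_distrib del: of_real_sum)
  show ?thesis
    using trace_square_le_rank [OF F, where n = n and a = a and b = b] \<mu> unfolding l
    by (simp add: ab norm_mult power_mult_distrib)
qed

section \<open>Double sums and the autocorrelation of \<open>\<mu>\<close>\<close>

text \<open>The substitution \<open>l = k - j\<close> groups the pairs by their difference. Taking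
  \<open>a = 1\<close> evaluates the sum of all \<open>(\<gamma> l)\<^sup>2\<close>; taking squared
  moduli of \<open>c\<close> identifies the quadratic term \<open>T\<close>.\<close>

lemma has_sum_autocorrelation:
  fixes \<mu> a :: "int \<Rightarrow> real"
  assumes s: "(\<lambda>(j, k). \<mu> j * \<mu> k * a (k - j)) summable_on UNIV"
    and s1: "(\<lambda>(j, k). \<mu> j * \<mu> k) summable_on UNIV"
  shows "((\<lambda>l. (\<Sum>\<^sub>\<infinity>j. \<mu> j * \<mu> (j + l)) * a l) has_sum
    (\<Sum>\<^sub>\<infinity>(j, k). \<mu> j * \<mu> k * a (k - j))) UNIV"
proof -
  have bij: "bij_betw (\<lambda>(l, j). (j, j + l)) UNIV (UNIV :: (int \<times> int) set)"
    by (rule bij_betwI [where g = "\<lambda>(j, k). (k - j, j)"]) auto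
  have "((\<lambda>(l, j). \<mu> j * \<mu> (j + l) * a l) has_sum (\<Sum>\<^sub>\<infinity>(j, k). \<mu> j * \<mu> k * a (k - j))) UNIV"
    using iffD2 [OF has_sum_reindex_bij_betw [OF bij] has_sum_infsum [OF s]]
    by (simp add: case_prod_unfold)
  then have h: "((\<lambda>(l, j). \<mu> j * \<mu> (j + l) * a l) has_sum (\<Sum>\<^sub>\<infinity>(j, k). \<mu> j * \<mu> k * a (k - j)))
      (Sigma UNIV (\<lambda>_. UNIV))"
    by simp
  \<comment> \<open>Convergence of the unweighted inner series allows the factor \<open>a l\<close>
    to be pulled out of the sum over \<open>j\<close>.\<close>
  have "(\<lambda>(l, j). \<mu> j * \<mu> (j + l)) summable_on UNIV"
    using iffD2 [OF summable_on_reindex_bij_betw [OF bij] s1] by (simp add: case_prod_unfold)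
  then have "(\<lambda>j. \<mu> j * \<mu> (j + l)) summable_on UNIV" for l
    using summable_on_SigmaD1 [of "\<lambda>l j. \<mu> j * \<mu> (j + l)" UNIV "\<lambda>_. UNIV" l] by simp
  then have "((\<lambda>j. \<mu> j * \<mu> (j + l) * a l) has_sum (\<Sum>\<^sub>\<infinity>j. \<mu> j * \<mu> (j + l)) * a l) UNIV" for l
    by (intro has_sum_cmult_left has_sum_infsum)
  with h show ?thesis by (intro has_sum_SigmaD [OF h]) simp
qed

lemma has_sum_square:
  fixes \<mu> :: "'a \<Rightarrow> real"
  assumes \<mu>: "\<And>j. \<mu> j \<ge> 0" and s: "\<mu> summable_on UNIV"
  shows "((\<lambda>(j, k). \<mu> j * \<mu> k) has_sum (infsum \<mu> UNIV)\<^sup>2) UNIV"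
proof -
  have h: "((\<lambda>k. \<mu> j * \<mu> k) has_sum \<mu> j * infsum \<mu> UNIV) UNIV" for j
    by (intro has_sum_cmult_right has_sum_infsum s)
  have g: "((\<lambda>j. \<mu> j * infsum \<mu> UNIV) has_sum infsum \<mu> UNIV * infsum \<mu> UNIV) UNIV"
    by (intro has_sum_cmult_left has_sum_infsum s)
  have "(\<lambda>(j, k). \<mu> j * \<mu> k) summable_on Sigma UNIV (\<lambda>_. UNIV)"
    by (rule summable_on_SigmaI [where g = "\<lambda>j. \<mu> j * infsum \<mu> UNIV"])
      (use h g \<mu> in \<open>auto simp: summable_on_def\<close>)
  then show ?thesis
    using has_sum_SigmaI [where f = "\<lambda>(j, k). \<mu> j * \<mu> k" and B = "\<lambda>_. UNIV", OF _ g] h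
    by (simp add: power2_eq_square)
qed

section \<open>Lower bound for the worst case error of one quadrature rule\<close>

lemma has_sum_finite_sum:
  fixes f :: "'i \<Rightarrow> 'a \<Rightarrow> 'b :: topological_comm_monoid_add"
  assumes "finite I" and "\<And>i. i \<in> I \<Longrightarrow> (f i has_sum S i) A"
  shows "((\<lambda>x. \<Sum>i\<in>I. f i x) has_sum (\<Sum>i\<in>I. S i)) A"
  using assms by (induction I rule: finite_induct) (auto intro!: has_sum_add)

text \<open>The fooling function is the normalised representer of the error functional.\<close>

lemma worst_case_error_ge:
  assumes \<gamma>: "(\<lambda>l. (\<gamma> l)\<^sup>2) summable_on UNIV"
    and E: "((\<lambda>l. (\<gamma> l)\<^sup>2 * (cmod ((if l = 0 then 1 else 0) - (\<Sum>i<n. w i * trig l (x i))))\<^sup>2) has_sum E) UNIV"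
  shows "sqrt E \<le> worst_case_error \<gamma> (quadrature n w x)"
proof -
  define U where "U = {f \<in> H_space \<gamma>. H_norm \<gamma> f \<le> 1}"
  define err where "err = (\<lambda>f. cmod (INT01 f - quadrature n w x f))"
  have up: "err f \<le> worst_case_error \<gamma> (quadrature n w x)" if "f \<in> U" for f
    unfolding worst_case_error_def err_def
    by (rule cSUP_upper) (use that bdd_above_worst_case_error [OF \<gamma>] in \<open>auto simp: U_def\<close>)
  have E0: "0 \<le> E" using E by (rule has_sum_nonneg) simp
  show ?thesis
  proof (cases "E = 0")
    case True
    have "0 \<le> err (\<lambda>_. 0)" by (simp add: err_def)
    also have "\<dots> \<le> worst_case_error \<gamma> (quadrature n w x)"
      using up zero_in_unit_ball by (simp add: U_def)
    finally show ?thesis using True by simp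
  next
    case False
    define R where "R = sqrt E"
    have R: "R > 0" "R\<^sup>2 = E" using False E0 by (auto simp: R_def)
    \<comment> \<open>\<open>d l\<close> is the error of the rule on \<open>trig l\<close>. The
      representer of the error functional has coefficients
      \<open>(\<gamma> l)\<^sup>2 * cnj (d l)\<close> and squared norm \<open>E\<close>, hence the
      division by \<open>R = sqrt E\<close>.\<close>
    define d where "d = (\<lambda>l::int. (if l = 0 then 1 else 0) - (\<Sum>i<n. w i * trig l (x i)))"
    define \<alpha> where "\<alpha> = (\<lambda>l. of_real ((\<gamma> l)\<^sup>2 / R) * cnj (d l))"
    define D where "D = 1 + (\<Sum>i<n. cmod (w i))"
    have d_le: "cmod (d l) \<le> D" for l
    proof -
      have "cmod (\<Sum>i<n. w i * trig l (x i)) \<le> (\<Sum>i<n. cmod (w i))"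
        by (rule sum_norm_le) (simp add: norm_mult)
      moreover have "cmod (if l = 0 then 1 else 0) \<le> 1" by simp
      ultimately show ?thesis unfolding d_def D_def
        by (meson add_mono norm_triangle_ineq4 order_trans)
    qed
    have "(\<lambda>l. (\<gamma> l)\<^sup>2 * (D / R)) summable_on UNIV"
      using \<gamma> by (rule summable_on_cmult_left)
    then have "(\<lambda>l. cmod (\<alpha> l)) summable_on UNIV"
    proof (rule summable_on_comparison_test)
      show "cmod (\<alpha> l) \<le> (\<gamma> l)\<^sup>2 * (D / R)" for l
        using mult_left_mono [OF d_le [of l], of "(\<gamma> l)\<^sup>2 / R"] R
        by (simp add: \<alpha>_def norm_mult norm_divide norm_power)
    qed simp
    then have abs: "(\<lambda>l. cmod (\<alpha> l * trig l y)) summable_on UNIV" for y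
      by (simp add: norm_mult)
    define f where "f = (\<lambda>y. \<Sum>\<^sub>\<infinity>l. \<alpha> l * trig l y)"
    have f: "((\<lambda>l. \<alpha> l * trig l y) has_sum f y) UNIV" for y
      unfolding f_def by (rule has_sum_infsum [OF abs_summable_summable [OF abs]])
    \<comment> \<open>This shows that \<open>f\<close> has norm exactly 1; the indices with
      \<open>\<gamma> l = 0\<close> contribute nothing.\<close>
    have "((\<lambda>l. (\<gamma> l)\<^sup>2 * (cmod (d l))\<^sup>2 / E) has_sum 1) UNIV"
      using has_sum_cmult_left [OF E, of "1 / E"] False by (simp add: d_def)
    moreover have "(\<gamma> l)\<^sup>2 * (cmod (d l))\<^sup>2 / E = (cmod (\<alpha> l))\<^sup>2 / (\<gamma> l)\<^sup>2" if "\<gamma> l \<noteq> 0" for l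
      using that R
      by (simp add: \<alpha>_def norm_mult norm_divide norm_power power_mult_distrib power_divide
          power2_eq_square field_simps)
    ultimately have n1: "((\<lambda>l. (cmod (\<alpha> l))\<^sup>2 / (\<gamma> l)\<^sup>2) has_sum 1) {l. \<gamma> l \<noteq> 0}"
      by (subst has_sum_cong_neutral [where T = UNIV and g = "\<lambda>l. (\<gamma> l)\<^sup>2 * (cmod (d l))\<^sup>2 / E"]) auto
    have exp: "H_expansion \<gamma> f \<alpha>"
      using f n1 by (auto simp: H_expansion_def \<alpha>_def summable_on_def)
    have "f \<in> U"
      using exp n1 by (auto simp: U_def H_space_def H_norm_def H_coeff_eq infsumI)
    have "(f has_integral \<alpha> 0) {0..1}"
      using H_expansion_Fourier [OF exp, of 0] by (simp add: trig_def)
    then have int: "INT01 f = \<alpha> 0" by (simp add: INT01_def integral_unique)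
    have quad: "((\<lambda>l. \<Sum>i<n. w i * (\<alpha> l * trig l (x i))) has_sum quadrature n w x f) UNIV"
      unfolding quadrature_def by (intro has_sum_finite_sum has_sum_cmult_right f) simp
    \<comment> \<open>The integral is written as a series supported at 0, so that integral and
      quadrature combine termwise into \<open>\<alpha> l * d l\<close>, with total
      \<open>E / R = R\<close>.\<close>
    have "((\<lambda>l. \<alpha> l * (if l = 0 then 1 else 0)) has_sum \<alpha> 0) UNIV"
      by (rule has_sum_finite_neutralI [where B = "{0}"]) auto
    from has_sum_add [OF this has_sum_uminusI [OF quad]]
    have "((\<lambda>l. \<alpha> l * (if l = 0 then 1 else 0) - (\<Sum>i<n. w i * (\<alpha> l * trig l (x i))))
        has_sum (INT01 f - quadrature n w x f)) UNIV"
      by (simp only: int add_uminus_conv_diff)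
    moreover have "\<alpha> l * (if l = 0 then 1 else 0) - (\<Sum>i<n. w i * (\<alpha> l * trig l (x i)))
        = of_real ((\<gamma> l)\<^sup>2 * (cmod (d l))\<^sup>2 * (1 / R))" for l
    proof -
      have "\<alpha> l * (if l = 0 then 1 else 0) - (\<Sum>i<n. w i * (\<alpha> l * trig l (x i))) = \<alpha> l * d l"
        by (simp add: d_def right_diff_distrib sum_distrib_left mult_ac)
      also have "\<dots> = of_real ((\<gamma> l)\<^sup>2 / R) * (d l * cnj (d l))"
        by (simp add: \<alpha>_def mult_ac)
      also have "\<dots> = of_real ((\<gamma> l)\<^sup>2 * (cmod (d l))\<^sup>2 * (1 / R))"
        by (simp add: complex_norm_square [symmetric])
      finally show ?thesis .
    qed
    moreover have "((\<lambda>l. complex_of_real ((\<gamma> l)\<^sup>2 * (cmod (d l))\<^sup>2 * (1 / R))) has_sum of_real (E * (1 / R))) UNIV"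
      by (intro has_sum_of_real has_sum_cmult_left) (use E in \<open>simp add: d_def\<close>)
    ultimately have "INT01 f - quadrature n w x f = of_real (E * (1 / R))"
      by (simp only: has_sum_unique)
    also have "E * (1 / R) = R" using R by (simp add: power2_eq_square field_simps)
    finally have "err f = R" using R by (simp add: err_def)
    with up [OF \<open>f \<in> U\<close>] show ?thesis by (simp add: R_def)
  qed
qed

section \<open>Minimising over \<open>c 0\<close>, and the conclusion\<close>

text \<open>Completing the square: after \<open>T\<close> is bounded below by
  \<open>S * s\<^sup>2 / r\<close>, the minimum lies at \<open>s = r * g / S\<close>. The case
  \<open>r = 0\<close> is the empty rule, where \<open>s\<close> is an empty sum.\<close>

lemma quadratic_lower_bound:
  fixes g S T s r :: real
  assumes "S > 0" and "S * s\<^sup>2 \<le> r * T" and "0 \<le> r" and "r = 0 \<Longrightarrow> s = 0" and "T \<ge> 0"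
  shows "g * (1 - r * g / S) \<le> g - 2 * g * s + T"
proof (cases "r = 0")
  case True
  then show ?thesis using assms by simp
next
  case False
  have "0 \<le> (S * s - r * g)\<^sup>2 / (r * S)" using assms by simp
  also have "\<dots> = S * s\<^sup>2 / r - 2 * g * s + r * g\<^sup>2 / S"
    using False assms by (simp add: power2_eq_square field_simps)
  also have "S * s\<^sup>2 / r \<le> T" using False assms by (simp add: field_simps)
  finally show ?thesis by (simp add: power2_eq_square algebra_simps)
qed

theorem theorem1:
  fixes \<mu> \<gamma> :: "int \<Rightarrow> real" and n :: nat
  assumes "\<And>j. \<mu> j \<ge> 0"
    and "\<mu> summable_on UNIV"
    and "\<mu> \<noteq> (\<lambda>_. 0)"
    and "\<And>l. \<gamma> l \<ge> 0"
    and "\<And>l. (\<gamma> l)\<^sup>2 = (\<Sum>\<^sub>\<infinity>j. \<mu> j * \<mu> (j + l))"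
  shows "(min_error n \<gamma>)\<^sup>2 \<ge> (\<gamma> 0)\<^sup>2 * (1 - real n * (\<gamma> 0)\<^sup>2 / (\<Sum>\<^sub>\<infinity>l. (\<gamma> l)\<^sup>2))"
proof -
  define M where "M = infsum \<mu> UNIV"
  note \<mu> = assms(1)
  have sq: "((\<lambda>(j, k). \<mu> j * \<mu> k) has_sum M\<^sup>2) UNIV"
    unfolding M_def using assms(1,2) by (rule has_sum_square)
  then have sq_s: "(\<lambda>(j, k). \<mu> j * \<mu> k) summable_on UNIV" by (auto simp: summable_on_def)
  have \<gamma>_sum: "((\<lambda>l. (\<gamma> l)\<^sup>2) has_sum M\<^sup>2) UNIV"
    using has_sum_autocorrelation [of \<mu> "\<lambda>_. 1"] sq sq_s by (simp add: assms(5) infsumI)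
  then have \<gamma>_s: "(\<lambda>l. (\<gamma> l)\<^sup>2) summable_on UNIV" by (auto simp: summable_on_def)
  obtain j0 where "\<mu> j0 \<noteq> 0" using assms(3) by auto
  then have "0 < sum \<mu> {j0}" using \<mu> [of j0] by simp
  also have "\<dots> \<le> M" unfolding M_def
    by (rule finite_sum_le_infsum) (use assms in auto)
  finally have M: "0 < M" .
  define L where "L = (\<gamma> 0)\<^sup>2 * (1 - real n * (\<gamma> 0)\<^sup>2 / M\<^sup>2)"
  \<comment> \<open>\<open>L\<close> can be negative for large \<open>n\<close>; truncating at 0
    keeps the inequality valid when it is squared at the end.\<close>
  have "sqrt (max 0 L) \<le> worst_case_error \<gamma> (quadrature n w x)" for w x
  proof -
    define c where "c = (\<lambda>l. \<Sum>i<n. w i * trig l (x i))"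
    define C where "C = (\<Sum>i<n. cmod (w i))"
    have c_le: "(cmod (c l))\<^sup>2 \<le> C\<^sup>2" for l
      unfolding c_def C_def
      by (intro power_mono sum_norm_le) (auto simp: norm_mult)
    have "(\<lambda>p. (case p of (j, k) \<Rightarrow> \<mu> j * \<mu> k) * C\<^sup>2) summable_on UNIV"
      using sq_s by (rule summable_on_cmult_left)
    then have dbl: "(\<lambda>(j, k). \<mu> j * \<mu> k * (cmod (c (k - j)))\<^sup>2) summable_on UNIV"
      by (rule summable_on_comparison_test) (auto simp: \<mu> intro!: mult_left_mono c_le)
    define T where "T = (\<Sum>\<^sub>\<infinity>(j, k). \<mu> j * \<mu> k * (cmod (c (k - j)))\<^sup>2)"
    have T: "((\<lambda>l. (\<gamma> l)\<^sup>2 * (cmod (c l))\<^sup>2) has_sum T) UNIV"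
      using has_sum_autocorrelation [of \<mu> "\<lambda>l. (cmod (c l))\<^sup>2", OF dbl sq_s]
      by (simp add: assms(5) T_def)
    have c0: "c 0 = (\<Sum>i<n. w i)" by (simp add: c_def trig_def)
    \<comment> \<open>The rank inequality is available on finite sections only. Its right side is at
      most the full sum \<open>T\<close>, as all terms are non-negative; the left side is then
      passed to the limit along finite sets.\<close>
    have fin: "(sum \<mu> F)\<^sup>2 * (cmod (c 0))\<^sup>2 \<le> real n * T" if "finite F" for F
    proof -
      have "(sum \<mu> F)\<^sup>2 * (cmod (c 0))\<^sup>2
          \<le> real n * (\<Sum>j\<in>F. \<Sum>k\<in>F. \<mu> j * \<mu> k * (cmod (c (k - j)))\<^sup>2)"
        unfolding c0 unfolding c_def using that \<mu> by (rule trig_quadratic_form_lower_bound)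
      also have "(\<Sum>j\<in>F. \<Sum>k\<in>F. \<mu> j * \<mu> k * (cmod (c (k - j)))\<^sup>2)
          = (\<Sum>(j, k)\<in>F \<times> F. \<mu> j * \<mu> k * (cmod (c (k - j)))\<^sup>2)"
        by (rule sum.cartesian_product)
      also have "real n * \<dots> \<le> real n * T"
        unfolding T_def
        by (intro mult_left_mono finite_sum_le_infsum dbl) (use that \<mu> in auto)
      finally show ?thesis .
    qed
    have "(sum \<mu> \<longlongrightarrow> M) (finite_subsets_at_top UNIV)"
      using has_sum_infsum [OF assms(2)] by (simp add: has_sum_def M_def)
    then have "((\<lambda>F. (sum \<mu> F)\<^sup>2 * (cmod (c 0))\<^sup>2) \<longlongrightarrow> M\<^sup>2 * (cmod (c 0))\<^sup>2) (finite_subsets_at_top UNIV)"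
      by (intro tendsto_intros)
    then have lim: "M\<^sup>2 * (cmod (c 0))\<^sup>2 \<le> real n * T"
      by (rule tendsto_upperbound)
        (auto intro!: eventually_finite_subsets_at_top_weakI fin)
    \<comment> \<open>The cross term of the expanded square contains only the real part of
      \<open>c 0\<close>.\<close>
    have "M\<^sup>2 * (Re (c 0))\<^sup>2 \<le> M\<^sup>2 * (cmod (c 0))\<^sup>2"
      by (intro mult_left_mono) (auto simp: cmod_power2)
    with lim have key: "M\<^sup>2 * (Re (c 0))\<^sup>2 \<le> real n * T" by linarith
    define E where "E = (\<gamma> 0)\<^sup>2 - 2 * (\<gamma> 0)\<^sup>2 * Re (c 0) + T"
    \<comment> \<open>The error series differs from the series of \<open>T\<close> only at
      \<open>l = 0\<close>, where expanding the square of \<open>cmod (1 - c 0)\<close> adds this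
      single term.\<close>
    have "((\<lambda>l. if l = 0 then (\<gamma> 0)\<^sup>2 - 2 * (\<gamma> 0)\<^sup>2 * Re (c 0) else 0) has_sum
        ((\<gamma> 0)\<^sup>2 - 2 * (\<gamma> 0)\<^sup>2 * Re (c 0))) UNIV"
      by (rule has_sum_finite_neutralI [where B = "{0}"]) auto
    moreover have sq_diff: "(cmod (1 - z))\<^sup>2 = 1 - 2 * Re z + (cmod z)\<^sup>2" for z
      unfolding cmod_power2 by (simp add: power2_eq_square algebra_simps)
    ultimately
    have "((\<lambda>l. (\<gamma> l)\<^sup>2 * (cmod ((if l = 0 then 1 else 0) - c l))\<^sup>2) has_sum E) UNIV"
      unfolding E_def
      by (intro has_sum_cong [THEN iffD1, OF _ has_sum_add [OF _ T]])
        (auto simp: sq_diff algebra_simps)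
    then have "sqrt E \<le> worst_case_error \<gamma> (quadrature n w x)"
      using worst_case_error_ge [OF \<gamma>_s] by (simp add: c_def)
    moreover have "0 \<le> T" using T by (rule has_sum_nonneg) simp
    then have "L \<le> E"
      unfolding E_def L_def
      by (intro quadratic_lower_bound key) (use M in \<open>auto simp: c_def\<close>)
    moreover have "0 \<le> E"
      using \<open>((\<lambda>l. (\<gamma> l)\<^sup>2 * (cmod ((if l = 0 then 1 else 0) - c l))\<^sup>2) has_sum E) UNIV\<close>
      by (rule has_sum_nonneg) simp
    ultimately show ?thesis
      by (meson max.boundedI order_trans real_sqrt_le_mono)
  qed
  \<comment> \<open>The infimum ranges over a non-empty set: placing all points at 0 is
    admissible.\<close>
  then have "sqrt (max 0 L) \<le> min_error n \<gamma>"
    unfolding min_error_def by (intro cINF_greatest) (auto intro!: exI [of _ "\<lambda>_. 0"])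
  then have "(sqrt (max 0 L))\<^sup>2 \<le> (min_error n \<gamma>)\<^sup>2" by (intro power_mono) auto
  then have "L \<le> (min_error n \<gamma>)\<^sup>2" by simp
  then show ?thesis using \<gamma>_sum by (simp add: L_def infsumI)
qed

end
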